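(* Let $\mathfrak R$ be a complete, separated topological associative ring with a base of neighborhoods of zero formed by open right ideals. Let $\mathfrak H\subset\mathfrak R$ be a topologically left T-nilpotent strongly closed two-sided ideal such that the quotient ring $\mathfrak S=\mathfrak R/\mathfrak H$ (with the quotient topology) is isomorphic, as a topological ring, to the product $\prod_{\gamma\in\Gamma}S_\gamma$ (with the product topology) of a family of discrete rings $S_\gamma$, each of which is simple Artinian. Then $\mathfrak H$ is the topological Jacobson radical of the topological ring $\mathfrak R$, and $\mathfrak H$ coincides with the Jacobson radical $H$ of the ring $\mathfrak R$ viewed as an abstract ring (without the topology).
   Context: Rings are associative with unit. All topological abelian groups/rings have a base of neighborhoods of zero consisting of open subgroups; such a group $A$ is separated (resp. complete) if $A\to\varprojlim_U A/U$ ($U$ ranging over open subgroups) is injective (resp. surjective). The topological Jacobson radical of $\mathfrak R$ is the intersection of all maximal right ideals of $\mathfrak R$ that are open. For a complete, separated topological abelian group $\mathfrak A$ and a set $X$, $\mathfrak A[[X]]$ is the group of formal linear combinations $\sum_{x\in X}a_xx$ with $a_x\in\mathfrak A$ such that for every open subgroup $\mathfrak U\subset\mathfrak A$ one has $a_x\in\mathfrak U$ for all but finitely many $x$. A closed subgroup $\mathfrak H$ of $\mathfrak A$ is strongly closed if $\mathfrak A/\mathfrak H$ is complete in the quotient topology and the induced map $\mathfrak A[[X]]\to(\mathfrak A/\mathfrak H)[[X]]$ is surjective for every set $X$. An ideal $\mathfrak H$ is topologically left T-nilpotent if for every sequence $a_1,a_2,\ldots$ in $\mathfrak H$ the sequence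 $a_1,\ a_1a_2,\ a_1a_2a_3,\dots$ converges to zero. *)

theory Defs
  imports "HOL-Analysis.Function_Topology" "HOL-Analysis.Product_Topology" "HOL-Algebra.QuotRing"
begin

section \<open>Topological abelian groups with a base of open subgroups\<close>

text \<open>
  Abelian groups are written multiplicatively, so that \<open>G Mod H\<close> is available; for a ring \<open>R\<close>
  they are applied to \<open>add_monoid R\<close>.
\<close>

definition open_subgroups :: "('a, 'm) monoid_scheme \<Rightarrow> 'a topology \<Rightarrow> 'a set set" where
  "open_subgroups G T = {U. subgroup U G \<and> openin T U}"

definition topological_ab_group :: "('a, 'm) monoid_scheme \<Rightarrow> 'a topology \<Rightarrow> bool" where
  "topological_ab_group G T \<longleftrightarrow>
     comm_group G \<and> topspace T = carrier G \<and>
     continuous_map (prod_topology T T) T (\<lambda>(x, y). x \<otimes>\<^bsub>G\<^esub> y) \<and>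
     continuous_map T T (\<lambda>x. inv\<^bsub>G\<^esub> x) \<and>
     (\<forall>W. openin T W \<and> \<one>\<^bsub>G\<^esub> \<in> W \<longrightarrow> (\<exists>U \<in> open_subgroups G T. U \<subseteq> W))"

text \<open>
  The inverse limit of the quotients \<open>G/U\<close>: for \<open>U \<subseteq> V\<close> the transition map sends a
  coset of \<open>U\<close> to the unique coset of \<open>V\<close> containing it.
\<close>

definition coset_limit ::
    "('a, 'm) monoid_scheme \<Rightarrow> 'a topology \<Rightarrow> ('a set \<Rightarrow> 'a set) set" where
  "coset_limit G T =
     {c \<in> (\<Pi>\<^sub>E U \<in> open_subgroups G T. carrier (G Mod U)).
        \<forall>U \<in> open_subgroups G T. \<forall>V \<in> open_subgroups G T. U \<subseteq> V \<longrightarrow> c U \<subseteq> c V}"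

definition to_coset_limit ::
    "('a, 'm) monoid_scheme \<Rightarrow> 'a topology \<Rightarrow> 'a \<Rightarrow> 'a set \<Rightarrow> 'a set" where
  "to_coset_limit G T a = (\<lambda>U \<in> open_subgroups G T. U #>\<^bsub>G\<^esub> a)"

definition separated_ab_group :: "('a, 'm) monoid_scheme \<Rightarrow> 'a topology \<Rightarrow> bool" where
  "separated_ab_group G T \<longleftrightarrow> inj_on (to_coset_limit G T) (carrier G)"

definition complete_ab_group :: "('a, 'm) monoid_scheme \<Rightarrow> 'a topology \<Rightarrow> bool" where
  "complete_ab_group G T \<longleftrightarrow> to_coset_limit G T ` carrier G = coset_limit G T"

definition coset_topology ::
    "('a, 'm) monoid_scheme \<Rightarrow> 'a topology \<Rightarrow> 'a set \<Rightarrow> 'a set topology" where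
  "coset_topology G T H =
     topology (\<lambda>V. V \<subseteq> carrier (G Mod H) \<and> openin T {x \<in> carrier G. H #>\<^bsub>G\<^esub> x \<in> V})"

text \<open>The group \<open>G[[X]]\<close>, a formal combination being its family of coefficients.\<close>

definition formal_combinations ::
    "('a, 'm) monoid_scheme \<Rightarrow> 'a topology \<Rightarrow> 'x set \<Rightarrow> ('x \<Rightarrow> 'a) set" where
  "formal_combinations G T X =
     {a \<in> X \<rightarrow>\<^sub>E carrier G. \<forall>U \<in> open_subgroups G T. finite {x \<in> X. a x \<notin> U}}"

text \<open>
  The index sets \<open>X\<close> range over the subsets of one type that is large enough: since \<open>G/H\<close> is
  separated, each of its nonzero elements occurs only finitely often in a formal combination.
  Lemma \<open>strongly_closed_imp_all_index_types\<close> below yields surjectivity for \<open>X\<close> in any type.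
\<close>

definition strongly_closed ::
    "('a, 'm) monoid_scheme \<Rightarrow> 'a topology \<Rightarrow> 'a set \<Rightarrow> bool" where
  "strongly_closed G T H \<longleftrightarrow>
     subgroup H G \<and> closedin T H \<and>
     complete_ab_group (G Mod H) (coset_topology G T H) \<and>
     (\<forall>X :: ('a set \<times> nat) set.
        (\<lambda>a. \<lambda>x\<in>X. H #>\<^bsub>G\<^esub> a x) ` formal_combinations G T X =
          formal_combinations (G Mod H) (coset_topology G T H) X)"


section \<open>Topological rings\<close>

definition topological_ring :: "('a, 'm) ring_scheme \<Rightarrow> 'a topology \<Rightarrow> bool" where
  "topological_ring R T \<longleftrightarrow>
     ring R \<and> topological_ab_group (add_monoid R) T \<and>
     continuous_map (prod_topology T T) T (\<lambda>(x, y). x \<otimes>\<^bsub>R\<^esub> y)"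

definition topological_ring_isomorphic ::
    "('a, 'm) ring_scheme \<Rightarrow> 'a topology \<Rightarrow> ('b, 'n) ring_scheme \<Rightarrow> 'b topology \<Rightarrow> bool" where
  "topological_ring_isomorphic R T R' T' \<longleftrightarrow> (\<exists>\<phi> \<in> ring_iso R R'. homeomorphic_map T T' \<phi>)"

definition product_ring :: "'i set \<Rightarrow> ('i \<Rightarrow> ('b, 'n) ring_scheme) \<Rightarrow> ('i \<Rightarrow> 'b) ring" where
  "product_ring I S =
     \<lparr>carrier = (\<Pi>\<^sub>E i\<in>I. carrier (S i)),
      mult = (\<lambda>x y. \<lambda>i\<in>I. x i \<otimes>\<^bsub>S i\<^esub> y i),
      one = (\<lambda>i\<in>I. \<one>\<^bsub>S i\<^esub>),
      zero = (\<lambda>i\<in>I. \<zero>\<^bsub>S i\<^esub>),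
      add = (\<lambda>x y. \<lambda>i\<in>I. x i \<oplus>\<^bsub>S i\<^esub> y i)\<rparr>"

definition right_ideal :: "'a set \<Rightarrow> ('a, 'm) ring_scheme \<Rightarrow> bool" where
  "right_ideal J R \<longleftrightarrow>
     additive_subgroup J R \<and> (\<forall>x\<in>J. \<forall>r\<in>carrier R. x \<otimes>\<^bsub>R\<^esub> r \<in> J)"

definition left_ideal :: "'a set \<Rightarrow> ('a, 'm) ring_scheme \<Rightarrow> bool" where
  "left_ideal J R \<longleftrightarrow>
     additive_subgroup J R \<and> (\<forall>x\<in>J. \<forall>r\<in>carrier R. r \<otimes>\<^bsub>R\<^esub> x \<in> J)"

definition maximal_right_ideal :: "'a set \<Rightarrow> ('a, 'm) ring_scheme \<Rightarrow> bool" where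
  "maximal_right_ideal J R \<longleftrightarrow>
     right_ideal J R \<and> J \<noteq> carrier R \<and>
     (\<forall>K. right_ideal K R \<and> J \<subseteq> K \<longrightarrow> K = J \<or> K = carrier R)"

definition base_of_open_right_ideals :: "('a, 'm) ring_scheme \<Rightarrow> 'a topology \<Rightarrow> bool" where
  "base_of_open_right_ideals R T \<longleftrightarrow>
     (\<forall>W. openin T W \<and> \<zero>\<^bsub>R\<^esub> \<in> W \<longrightarrow> (\<exists>J. right_ideal J R \<and> openin T J \<and> J \<subseteq> W))"

text \<open>The intersections are taken inside \<open>R\<close>: the empty one is the whole ring.\<close>

definition jacobson_radical :: "('a, 'm) ring_scheme \<Rightarrow> 'a set" where
  "jacobson_radical R = carrier R \<inter> \<Inter> {J. maximal_right_ideal J R}"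

definition topological_jacobson_radical ::
    "('a, 'm) ring_scheme \<Rightarrow> 'a topology \<Rightarrow> 'a set" where
  "topological_jacobson_radical R T =
     carrier R \<inter> \<Inter> {J. maximal_right_ideal J R \<and> openin T J}"

primrec partial_product :: "('a, 'm) ring_scheme \<Rightarrow> (nat \<Rightarrow> 'a) \<Rightarrow> nat \<Rightarrow> 'a" where
  "partial_product R a 0 = a 0"
| "partial_product R a (Suc n) = partial_product R a n \<otimes>\<^bsub>R\<^esub> a (Suc n)"

definition topologically_left_T_nilpotent ::
    "('a, 'm) ring_scheme \<Rightarrow> 'a topology \<Rightarrow> 'a set \<Rightarrow> bool" where
  "topologically_left_T_nilpotent R T H \<longleftrightarrow>
     (\<forall>a. range a \<subseteq> H \<longrightarrow> limitin T (partial_product R a) \<zero>\<^bsub>R\<^esub> sequentially)"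

definition simple_ring :: "('a, 'm) ring_scheme \<Rightarrow> bool" where
  "simple_ring R \<longleftrightarrow>
     ring R \<and> carrier R \<noteq> {\<zero>\<^bsub>R\<^esub>} \<and> (\<forall>I. ideal I R \<longrightarrow> I = {\<zero>\<^bsub>R\<^esub>} \<or> I = carrier R)"

definition artinian_ring :: "('a, 'm) ring_scheme \<Rightarrow> bool" where
  "artinian_ring R \<longleftrightarrow>
     ring R \<and>
     (\<forall>J :: nat \<Rightarrow> 'a set. (\<forall>n. right_ideal (J n) R) \<and> decseq J \<longrightarrow> (\<exists>N. \<forall>n\<ge>N. J n = J N)) \<and>
     (\<forall>J :: nat \<Rightarrow> 'a set. (\<forall>n. left_ideal (J n) R) \<and> decseq J \<longrightarrow> (\<exists>N. \<forall>n\<ge>N. J n = J N))"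


section \<open>The quotient topology, and strong closedness for arbitrary index types\<close>

lemma openin_coset_topology:
  "openin (coset_topology G T H) V \<longleftrightarrow>
     V \<subseteq> carrier (G Mod H) \<and> openin T {x \<in> carrier G. H #>\<^bsub>G\<^esub> x \<in> V}"
proof -
  let ?P = "\<lambda>V. {x \<in> carrier G. H #>\<^bsub>G\<^esub> x \<in> V}"
  have "istopology (\<lambda>V. V \<subseteq> carrier (G Mod H) \<and> openin T (?P V))"
    unfolding istopology_def
  proof (intro conjI allI impI)
    fix A B
    assume "A \<subseteq> carrier (G Mod H) \<and> openin T (?P A)" "B \<subseteq> carrier (G Mod H) \<and> openin T (?P B)"
    moreover have "?P (A \<inter> B) = ?P A \<inter> ?P B" by blast
    ultimately show "A \<inter> B \<subseteq> carrier (G Mod H)" "openin T (?P (A \<inter> B))" by auto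
  next
    fix \<K> assume *: "\<forall>K\<in>\<K>. K \<subseteq> carrier (G Mod H) \<and> openin T (?P K)"
    have "?P (\<Union>\<K>) = (\<Union>K\<in>\<K>. ?P K)" by blast
    with * show "\<Union>\<K> \<subseteq> carrier (G Mod H)" "openin T (?P (\<Union>\<K>))" by auto
  qed
  then show ?thesis
    unfolding coset_topology_def by (simp add: topology_inverse')
qed

lemma quotient_map_coset_topology:
  assumes "topspace T = carrier G"
  shows "quotient_map T (coset_topology G T H) (\<lambda>x. H #>\<^bsub>G\<^esub> x)"
proof -
  have "openin (coset_topology G T H) (carrier (G Mod H))"
    unfolding openin_coset_topology
    using openin_topspace[of T] assms
    by (auto simp: carrier_FactGroup intro: back_subst[of "openin T"])
  then have "topspace (coset_topology G T H) = carrier (G Mod H)"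
    by (metis openin_coset_topology openin_subset openin_topspace subset_antisym)
  then show ?thesis
    unfolding quotient_map_def by (auto simp: assms openin_coset_topology carrier_FactGroup)
qed

context
  fixes G :: "('a, 'm) monoid_scheme" and T H
  assumes top_group: "topological_ab_group G T" and sub_H: "subgroup H G"
begin

interpretation comm_group G
  using top_group by (simp add: topological_ab_group_def)

interpretation normal H G
  by (rule subgroup_imp_normal[OF sub_H])

interpretation quot: group_hom G "G Mod H" "\<lambda>x. H #>\<^bsub>G\<^esub> x"
  unfolding group_hom_def group_hom_axioms_def
  by (simp add: is_group factorgroup_is_group r_coset_hom_Mod)

lemma topspace_carrier: "topspace T = carrier G"
  using top_group by (simp add: topological_ab_group_def)

lemma openin_translate_vimage:
  assumes "openin T W" "g \<in> carrier G"
  shows "openin T {y \<in> carrier G. g \<otimes>\<^bsub>G\<^esub> y \<in> W}"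
proof -
  have "continuous_map T (prod_topology T T) (\<lambda>y. (g, y))"
    using assms topspace_carrier by (simp add: continuous_map_pairedI)
  moreover have "continuous_map (prod_topology T T) T (\<lambda>(x, y). x \<otimes>\<^bsub>G\<^esub> y)"
    using top_group by (simp add: topological_ab_group_def)
  ultimately have "continuous_map T T ((\<lambda>(x, y). x \<otimes>\<^bsub>G\<^esub> y) \<circ> (\<lambda>y. (g, y)))"
    by (rule continuous_map_compose)
  then show ?thesis
    using assms(1) topspace_carrier unfolding continuous_map_def by (auto simp: o_def)
qed

lemma openin_supergroup:
  assumes "subgroup V G" "U \<in> open_subgroups G T" "U \<subseteq> V"
  shows "openin T V"
proof (rule openin_subopen[THEN iffD2], rule ballI)
  fix v assume v: "v \<in> V"
  then have vG: "v \<in> carrier G" by (rule subgroup.mem_carrier[OF assms(1)])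
  have U: "subgroup U G" "openin T U" using assms(2) by (auto simp: open_subgroups_def)
  let ?W = "{y \<in> carrier G. inv\<^bsub>G\<^esub> v \<otimes>\<^bsub>G\<^esub> y \<in> U}"
  have "openin T ?W" using openin_translate_vimage[OF U(2)] vG by simp
  moreover have "v \<in> ?W" using vG subgroup.one_closed[OF U(1)] by simp
  moreover have "?W \<subseteq> V"
  proof
    fix y assume y: "y \<in> ?W"
    then have yG: "y \<in> carrier G" and "inv\<^bsub>G\<^esub> v \<otimes>\<^bsub>G\<^esub> y \<in> V" using assms(3) by blast+
    then have "v \<otimes>\<^bsub>G\<^esub> (inv\<^bsub>G\<^esub> v \<otimes>\<^bsub>G\<^esub> y) \<in> V"
      using subgroup.m_closed[OF assms(1) v] by blast
    moreover have "v \<otimes>\<^bsub>G\<^esub> (inv\<^bsub>G\<^esub> v \<otimes>\<^bsub>G\<^esub> y) = y"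
      by (simp only: m_assoc[OF vG inv_closed[OF vG] yG, symmetric] r_inv[OF vG] l_one[OF yG])
    ultimately show "y \<in> V" by (rule back_subst[of "\<lambda>z. z \<in> V"])
  qed
  ultimately show "\<exists>W. openin T W \<and> v \<in> W \<and> W \<subseteq> V" by blast
qed

lemma subgroup_coset_vimage:
  assumes V: "subgroup V (G Mod H)"
  shows "subgroup {x \<in> carrier G. H #>\<^bsub>G\<^esub> x \<in> V} G"
proof (rule subgroupI)
  show "{x \<in> carrier G. H #>\<^bsub>G\<^esub> x \<in> V} \<noteq> {}"
  proof -
    have "H #>\<^bsub>G\<^esub> \<one>\<^bsub>G\<^esub> \<in> V"
      using subgroup.one_closed[OF V] quot.hom_one by simp
    then show ?thesis by blast
  qed
  show "inv\<^bsub>G\<^esub> a \<in> {x \<in> carrier G. H #>\<^bsub>G\<^esub> x \<in> V}"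
    if "a \<in> {x \<in> carrier G. H #>\<^bsub>G\<^esub> x \<in> V}" for a
  proof -
    have "a \<in> carrier G" "H #>\<^bsub>G\<^esub> a \<in> V" using that by simp_all
    then show ?thesis
      using subgroup.m_inv_closed[OF V, of "H #>\<^bsub>G\<^esub> a"] quot.hom_inv[of a] by simp
  qed
  show "a \<otimes>\<^bsub>G\<^esub> b \<in> {x \<in> carrier G. H #>\<^bsub>G\<^esub> x \<in> V}"
    if "a \<in> {x \<in> carrier G. H #>\<^bsub>G\<^esub> x \<in> V}" "b \<in> {x \<in> carrier G. H #>\<^bsub>G\<^esub> x \<in> V}" for a b
  proof -
    have "a \<in> carrier G" "H #>\<^bsub>G\<^esub> a \<in> V" "b \<in> carrier G" "H #>\<^bsub>G\<^esub> b \<in> V"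
      using that by simp_all
    then show ?thesis
      using subgroup.m_closed[OF V, of "H #>\<^bsub>G\<^esub> a" "H #>\<^bsub>G\<^esub> b"] quot.hom_mult[of a b]
      by simp
  qed
qed auto

lemma open_subgroups_vimage:
  assumes "V \<in> open_subgroups (G Mod H) (coset_topology G T H)"
  shows "{x \<in> carrier G. H #>\<^bsub>G\<^esub> x \<in> V} \<in> open_subgroups G T"
  using assms subgroup_coset_vimage by (simp add: open_subgroups_def openin_coset_topology)

lemma open_subgroups_image:
  assumes "U \<in> open_subgroups G T"
  shows "(\<lambda>x. H #>\<^bsub>G\<^esub> x) ` U \<in> open_subgroups (G Mod H) (coset_topology G T H)"
proof -
  have U: "subgroup U G" using assms by (simp add: open_subgroups_def)
  have img: "subgroup ((\<lambda>x. H #>\<^bsub>G\<^esub> x) ` U) (G Mod H)"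
    by (rule quot.subgroup_img_is_subgroup[OF U])
  have "openin T {x \<in> carrier G. H #>\<^bsub>G\<^esub> x \<in> (\<lambda>x. H #>\<^bsub>G\<^esub> x) ` U}"
    by (rule openin_supergroup[OF subgroup_coset_vimage[OF img] assms])
       (use subgroup.subset[OF U] in auto)
  with img show ?thesis
    using subgroup.subset[OF img] by (simp add: open_subgroups_def openin_coset_topology)
qed

lemma coset_separation:
  assumes "closedin T H" "c \<in> carrier (G Mod H)" "c \<noteq> H"
  shows "\<exists>V \<in> open_subgroups (G Mod H) (coset_topology G T H). c \<notin> V"
proof -
  obtain x where x: "x \<in> carrier G" "c = H #>\<^bsub>G\<^esub> x"
    using assms(2) by (auto simp: carrier_FactGroup)
  have "x \<notin> H" using x assms(3) coset_join2[OF _ sub_H] by blast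
  have "openin T (carrier G - H)" using assms(1) topspace_carrier by (simp add: closedin_def)
  then have "openin T {y \<in> carrier G. x \<otimes>\<^bsub>G\<^esub> y \<in> carrier G - H}" (is "openin T ?W")
    using x by (intro openin_translate_vimage)
  moreover have "\<one>\<^bsub>G\<^esub> \<in> ?W" using x \<open>x \<notin> H\<close> by simp
  ultimately obtain U where U: "U \<in> open_subgroups G T" "U \<subseteq> ?W"
    using top_group unfolding topological_ab_group_def by blast
  have sU: "subgroup U G" using U by (simp add: open_subgroups_def)
  have "c \<notin> (\<lambda>x. H #>\<^bsub>G\<^esub> x) ` U"
  proof
    assume "c \<in> (\<lambda>x. H #>\<^bsub>G\<^esub> x) ` U"
    then obtain u where u: "u \<in> U" "H #>\<^bsub>G\<^esub> x = H #>\<^bsub>G\<^esub> u" using x by blast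
    have uG: "u \<in> carrier G" by (rule subgroup.mem_carrier[OF sU u(1)])
    have "x \<in> H #>\<^bsub>G\<^esub> u" using u x rcos_self[OF _ sub_H] by metis
    then obtain h where h: "h \<in> H" "x = h \<otimes>\<^bsub>G\<^esub> u" by (auto simp: r_coset_def)
    have hG: "h \<in> carrier G" by (rule subgroup.mem_carrier[OF sub_H h(1)])
    have "inv\<^bsub>G\<^esub> u \<in> ?W" using subgroup.m_inv_closed[OF sU u(1)] U(2) by blast
    moreover have "x \<otimes>\<^bsub>G\<^esub> inv\<^bsub>G\<^esub> u = h" using h hG uG by (simp add: m_assoc)
    ultimately show False using h by simp
  qed
  then show ?thesis using open_subgroups_image[OF U(1)] by blast
qed

lemma induced_formal_combination:
  assumes "a \<in> formal_combinations G T X"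
  shows "(\<lambda>x\<in>X. H #>\<^bsub>G\<^esub> a x) \<in> formal_combinations (G Mod H) (coset_topology G T H) X"
proof -
  have a: "a x \<in> carrier G" if "x \<in> X" for x
    using assms that by (auto simp: formal_combinations_def)
  have "finite {x \<in> X. H #>\<^bsub>G\<^esub> a x \<notin> V}"
    if "V \<in> open_subgroups (G Mod H) (coset_topology G T H)" for V
  proof -
    have "finite {x \<in> X. a x \<notin> {y \<in> carrier G. H #>\<^bsub>G\<^esub> y \<in> V}}"
      using assms open_subgroups_vimage[OF that] unfolding formal_combinations_def by blast
    then show ?thesis by (rule rev_finite_subset) auto
  qed
  then show ?thesis
    using a by (auto simp: formal_combinations_def carrier_FactGroup cong: conj_cong)
qed

lemma strongly_closed_imp_all_index_types:
  fixes X :: "'x set"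
  assumes sc: "strongly_closed G T H"
  shows "(\<lambda>a. \<lambda>x\<in>X. H #>\<^bsub>G\<^esub> a x) ` formal_combinations G T X =
           formal_combinations (G Mod H) (coset_topology G T H) X"
proof (intro equalityI subsetI)
  let ?Q = "G Mod H" and ?TQ = "coset_topology G T H"
  show "f \<in> formal_combinations ?Q ?TQ X"
    if "f \<in> (\<lambda>a. \<lambda>x\<in>X. H #>\<^bsub>G\<^esub> a x) ` formal_combinations G T X" for f
    using that induced_formal_combination by blast
  fix f assume f: "f \<in> formal_combinations ?Q ?TQ X"
  then have fQ: "f x \<in> carrier ?Q" if "x \<in> X" for x
    using that by (auto simp: formal_combinations_def)
  have fin: "finite {x \<in> X. f x \<notin> V}" if "V \<in> open_subgroups ?Q ?TQ" for V
    using f that by (simp add: formal_combinations_def)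
  define X' where "X' = {x \<in> X. f x \<noteq> H}"
  define F where "F c = {x \<in> X'. f x = c}" for c
  define e where "e x = (f x, to_nat_on (F (f x)) x)" for x
  have finF: "finite (F (f x))" if "x \<in> X'" for x
  proof -
    from that have "f x \<in> carrier ?Q" "f x \<noteq> H" using fQ by (auto simp: X'_def)
    then obtain V where V: "V \<in> open_subgroups ?Q ?TQ" "f x \<notin> V"
      using coset_separation sc unfolding strongly_closed_def by metis
    show ?thesis
      by (rule finite_subset[OF _ fin[OF V(1)]]) (use V(2) in \<open>auto simp: F_def X'_def\<close>)
  qed
  have inj: "inj_on e X'"
  proof (rule inj_onI)
    fix x y assume xy: "x \<in> X'" "y \<in> X'" "e x = e y"
    then have "x \<in> F (f x)" "y \<in> F (f x)" "to_nat_on (F (f x)) x = to_nat_on (F (f x)) y"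
      by (auto simp: F_def e_def)
    then show "x = y"
      using inj_on_to_nat_on[OF countable_finite[OF finF[OF xy(1)]]] by (meson inj_onD)
  qed
  have "(\<lambda>y\<in>e ` X'. fst y) \<in> formal_combinations ?Q ?TQ (e ` X')"
  proof -
    have "finite {y \<in> e ` X'. fst y \<notin> V}" if "V \<in> open_subgroups ?Q ?TQ" for V
      by (rule finite_subset[OF _ finite_imageI[OF fin[OF that], of e]])
         (auto simp: e_def X'_def)
    then show ?thesis
      using fQ by (auto simp: formal_combinations_def e_def X'_def cong: conj_cong)
  qed
  then obtain a where a: "a \<in> formal_combinations G T (e ` X')"
    and a_eq: "(\<lambda>y\<in>e ` X'. fst y) = (\<lambda>y\<in>e ` X'. H #>\<^bsub>G\<^esub> a y)"
    using sc unfolding strongly_closed_def by blast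
  have a_e: "H #>\<^bsub>G\<^esub> a (e x) = f x" if "x \<in> X'" for x
    using fun_cong[OF a_eq, of "e x"] that by (simp add: e_def)
  define b where "b = (\<lambda>x\<in>X. if x \<in> X' then a (e x) else \<one>\<^bsub>G\<^esub>)"
  have "b \<in> formal_combinations G T X"
  proof -
    have "finite {x \<in> X. b x \<notin> U}" if U: "U \<in> open_subgroups G T" for U
    proof -
      have "finite {y \<in> e ` X'. a y \<notin> U}"
        using a U by (simp add: formal_combinations_def)
      then have "finite {x \<in> X'. a (e x) \<notin> U}"
        by (rule finite_subset[of "e ` {x \<in> X'. a (e x) \<notin> U}", THEN finite_imageD, rotated])
           (use inj in \<open>auto intro: inj_on_subset\<close>)
      moreover have "\<one>\<^bsub>G\<^esub> \<in> U"
        by (rule subgroup.one_closed) (use U in \<open>simp add: open_subgroups_def\<close>)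
      ultimately show ?thesis
        by (rule_tac rev_finite_subset) (auto simp: b_def split: if_splits)
    qed
    moreover have "b \<in> X \<rightarrow>\<^sub>E carrier G"
      using a by (fastforce simp: b_def formal_combinations_def PiE_iff)
    ultimately show ?thesis by (simp add: formal_combinations_def)
  qed
  moreover have "f = (\<lambda>x\<in>X. H #>\<^bsub>G\<^esub> b x)"
  proof
    fix x
    have "f x = H" if "x \<in> X" "x \<notin> X'" using that by (simp add: X'_def)
    moreover have "H #>\<^bsub>G\<^esub> \<one>\<^bsub>G\<^esub> = H" using coset_mult_one subset by blast
    moreover have "f x = undefined" if "x \<notin> X"
      using f that by (auto simp: formal_combinations_def)
    ultimately show "f x = (\<lambda>x\<in>X. H #>\<^bsub>G\<^esub> b x) x"
      using a_e by (auto simp: b_def)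
  qed
  ultimately show "f \<in> (\<lambda>a. \<lambda>x\<in>X. H #>\<^bsub>G\<^esub> a x) ` formal_combinations G T X"
    by blast
qed

end

end

(*
  Completeness and h^n \<longlonglongrightarrow> 0 make the geometric series of h \<in> H converge to a right inverse of 1 - h, so
  the right ideal H lies in every maximal right ideal.  Conversely, in a simple ring the
  intersection of the maximal right ideals is a proper two-sided ideal, hence zero; pulling these
  right ideals back along the continuous projections R \<rightarrow> S \<gamma> gives open maximal right ideals of R
  whose intersection is H.
*)
theory Submission
  imports Defs
begin

section \<open>Maximal right ideals, their transport, and the Jacobson radical of an abstract
  ring\<close>

section \<open>Maximal right ideals\<close>

text \<open>Negatives come for free: \<open>\<ominus> x\<close> is \<open>x\<close> multiplied on
  the right by \<open>\<ominus> \<one>\<close>.\<close>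

lemma (in ring) right_idealI:
  assumes "J \<subseteq> carrier R" "\<zero> \<in> J"
    and "\<And>x y. x \<in> J \<Longrightarrow> y \<in> J \<Longrightarrow> x \<oplus> y \<in> J"
    and "\<And>x r. x \<in> J \<Longrightarrow> r \<in> carrier R \<Longrightarrow> x \<otimes> r \<in> J"
  shows "right_ideal J R"
proof -
  have "\<ominus> x \<in> J" if "x \<in> J" for x
    using assms(4)[OF that, of "\<ominus> \<one>"] that assms(1) by (auto simp: r_minus)
  then have "subgroup J (add_monoid R)"
    using assms by (intro add.subgroupI) (auto simp: a_inv_def)
  then show ?thesis
    using assms by (simp add: right_ideal_def additive_subgroup_def)
qed

lemma right_idealD:
  assumes "right_ideal J R"
  shows "J \<subseteq> carrier R" "\<zero>\<^bsub>R\<^esub> \<in> J"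
    and "\<And>x y. x \<in> J \<Longrightarrow> y \<in> J \<Longrightarrow> x \<oplus>\<^bsub>R\<^esub> y \<in> J"
    and "\<And>x r. x \<in> J \<Longrightarrow> r \<in> carrier R \<Longrightarrow> x \<otimes>\<^bsub>R\<^esub> r \<in> J"
proof -
  interpret additive_subgroup J R using assms by (simp add: right_ideal_def)
  show "J \<subseteq> carrier R" by (rule a_subset)
  show "\<zero>\<^bsub>R\<^esub> \<in> J" by (rule zero_closed)
  show "x \<oplus>\<^bsub>R\<^esub> y \<in> J" if "x \<in> J" "y \<in> J" for x y using that by (rule a_closed)
  show "x \<otimes>\<^bsub>R\<^esub> r \<in> J" if "x \<in> J" "r \<in> carrier R" for x r
    using assms that by (simp add: right_ideal_def)
qed

lemma (in ring) right_ideal_eq_carrier: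
  assumes "right_ideal J R" "\<one> \<in> J"
  shows "J = carrier R"
  using right_idealD(1)[OF assms(1)] right_idealD(4)[OF assms] by fastforce

lemma (in ring) right_ideal_adjoin:
  assumes J: "right_ideal J R" and a: "a \<in> carrier R"
  shows "right_ideal {j \<oplus> a \<otimes> r |j r. j \<in> J \<and> r \<in> carrier R} R"
proof (rule right_idealI)
  show "{j \<oplus> a \<otimes> r |j r. j \<in> J \<and> r \<in> carrier R} \<subseteq> carrier R"
    using right_idealD(1)[OF J] a by auto
  show "\<zero> \<in> {j \<oplus> a \<otimes> r |j r. j \<in> J \<and> r \<in> carrier R}"
    using right_idealD(2)[OF J] a by (force intro: exI[of _ \<zero>])
next
  fix x y
  assume "x \<in> {j \<oplus> a \<otimes> r |j r. j \<in> J \<and> r \<in> carrier R}"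
    and "y \<in> {j \<oplus> a \<otimes> r |j r. j \<in> J \<and> r \<in> carrier R}"
  then obtain j r k t where *: "x = j \<oplus> a \<otimes> r" "y = k \<oplus> a \<otimes> t"
    "j \<in> J" "r \<in> carrier R" "k \<in> J" "t \<in> carrier R" by blast
  then have "j \<in> carrier R" "k \<in> carrier R" using right_idealD(1)[OF J] by auto
  with * a have "x \<oplus> y = (j \<oplus> k) \<oplus> a \<otimes> (r \<oplus> t)"
    by (simp add: r_distr a_ac)
  with * show "x \<oplus> y \<in> {j \<oplus> a \<otimes> r |j r. j \<in> J \<and> r \<in> carrier R}"
    using right_idealD(3)[OF J] by blast
next
  fix x s
  assume "x \<in> {j \<oplus> a \<otimes> r |j r. j \<in> J \<and> r \<in> carrier R}" and s: "s \<in> carrier R"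
  then obtain j r where *: "x = j \<oplus> a \<otimes> r" "j \<in> J" "r \<in> carrier R" by blast
  then have "j \<in> carrier R" using right_idealD(1)[OF J] by auto
  with * a s have "x \<otimes> s = j \<otimes> s \<oplus> a \<otimes> (r \<otimes> s)"
    by (simp add: l_distr m_assoc)
  with * s show "x \<otimes> s \<in> {j \<oplus> a \<otimes> r |j r. j \<in> J \<and> r \<in> carrier R}"
    using right_idealD(4)[OF J] by blast
qed

text \<open>The right ideal M + aR contains M and the element a outside M, so maximality makes it
  the whole ring. The residual, pullback and quasi-regularity lemmas below all use maximality in
  this form.\<close>

lemma (in ring) maximal_right_ideal_decompose:
  assumes M: "maximal_right_ideal M R" and a: "a \<in> carrier R" "a \<notin> M" and x: "x \<in> carrier R"
  obtains m r where "m \<in> M" "r \<in> carrier R" "x = m \<oplus> a \<otimes> r"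
proof -
  let ?K = "{j \<oplus> a \<otimes> r |j r. j \<in> M \<and> r \<in> carrier R}"
  have rM: "right_ideal M R" using M by (simp add: maximal_right_ideal_def)
  note M_simps = right_idealD[OF rM]
  have "M \<subseteq> ?K"
  proof
    fix m assume m: "m \<in> M"
    then have "m = m \<oplus> a \<otimes> \<zero>" using M_simps(1) a by auto
    with m show "m \<in> ?K" by blast
  qed
  moreover have "a \<in> ?K"
  proof -
    have "a = \<zero> \<oplus> a \<otimes> \<one>" using a by simp
    then show ?thesis using M_simps(2) by blast
  qed
  moreover have "right_ideal ?K R" by (rule right_ideal_adjoin[OF rM a(1)])
  ultimately have "?K = carrier R" using M a(2) unfolding maximal_right_ideal_def by blast
  with x that show ?thesis by blast
qed

text \<open>Zorn's lemma for the right ideals that avoid \<open>\<one>\<close>. Avoiding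
  \<open>\<one>\<close> is the same as being proper, and it passes to unions of chains. The family
  is nonempty because \<open>\<one>\<close> differs from \<open>\<zero>\<close> in a nonzero
  ring.\<close>

lemma (in ring) maximal_right_ideal_exists:
  assumes "carrier R \<noteq> {\<zero>}"
  obtains M where "maximal_right_ideal M R"
proof -
  let ?A = "{J. right_ideal J R \<and> \<one> \<notin> J}"
  have "\<one> \<noteq> \<zero>" using assms carrier_one_zero by blast
  then have "{\<zero>} \<in> ?A" by (auto intro!: right_idealI)
  then have ne: "?A \<noteq> {}" by blast
  have "\<Union>C \<in> ?A" if "C \<noteq> {}" and C: "subset.chain ?A C" for C
  proof -
    have CA: "right_ideal J R" "\<one> \<notin> J" if "J \<in> C" for J
      using C that by (auto simp: subset.chain_def)
    have "right_ideal (\<Union>C) R"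
    proof (rule right_idealI)
      show "\<Union>C \<subseteq> carrier R" using right_idealD(1)[OF CA(1)] by blast
      show "\<zero> \<in> \<Union>C" using right_idealD(2)[OF CA(1)] \<open>C \<noteq> {}\<close> by blast
    next
      fix x y assume "x \<in> \<Union>C" "y \<in> \<Union>C"
      then obtain J K where JK: "J \<in> C" "K \<in> C" "x \<in> J" "y \<in> K" by blast
      then have "J \<subseteq> K \<or> K \<subseteq> J" using subset_chain_def C by metis
      with JK show "x \<oplus> y \<in> \<Union>C" using right_idealD(3)[OF CA(1)] by blast
    next
      fix x r assume "x \<in> \<Union>C" "r \<in> carrier R"
      then show "x \<otimes> r \<in> \<Union>C" using right_idealD(4)[OF CA(1)] by blast
    qed
    then show ?thesis using CA(2) by blast
  qed
  then have "\<exists>M\<in>?A. \<forall>X\<in>?A. M \<subseteq> X \<longrightarrow> X = M"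
    by (rule subset_Zorn_nonempty[OF ne])
  then obtain M where M: "M \<in> ?A" "\<forall>X\<in>?A. M \<subseteq> X \<longrightarrow> X = M" ..
  have "maximal_right_ideal M R"
    unfolding maximal_right_ideal_def using M right_ideal_eq_carrier by blast
  then show ?thesis by (rule that)
qed

text \<open>The set is the annihilator of the class of r in the simple right module R/M. This class
  is nonzero and hence generates R/M, so R modulo the annihilator is isomorphic to R/M and is simple
  too. The proof carries out this argument on elements.\<close>

lemma (in ring) maximal_right_ideal_residual:
  assumes M: "maximal_right_ideal M R" and r: "r \<in> carrier R" "r \<notin> M"
  shows "maximal_right_ideal {s \<in> carrier R. r \<otimes> s \<in> M} R"
proof -
  let ?N = "{s \<in> carrier R. r \<otimes> s \<in> M}"
  have rM: "right_ideal M R" using M by (simp add: maximal_right_ideal_def)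
  note M_simps = right_idealD[OF rM]
  have "right_ideal ?N R"
    using M_simps r by (intro right_idealI) (auto simp: r_distr m_assoc[symmetric])
  moreover have "?N \<noteq> carrier R"
  proof
    assume "?N = carrier R"
    then have "r \<otimes> \<one> \<in> M" by blast
    with r show False by simp
  qed
  moreover have "K = carrier R" if K: "right_ideal K R" "?N \<subseteq> K" "K \<noteq> ?N" for K
  proof -
    note K_simps = right_idealD[OF K(1)]
    obtain k where k: "k \<in> K" "k \<in> carrier R" "r \<otimes> k \<notin> M" using K K_simps(1) by blast
    have "s \<in> K" if s: "s \<in> carrier R" for s
    proof -
      \<comment> \<open>Since \<open>r \<otimes> k\<close> lies outside M, it generates everything
        modulo M. The coefficient t is chosen so that r sends
        \<open>s \<ominus> k \<otimes> t\<close> into M, which puts this difference into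
        \<open>?N\<close> and thus into K.\<close>
      obtain m t where m: "m \<in> M" "t \<in> carrier R" "r \<otimes> s = m \<oplus> r \<otimes> k \<otimes> t"
        using maximal_right_ideal_decompose[OF M, of "r \<otimes> k" "r \<otimes> s"] r k s by auto
      have mR: "m \<in> carrier R" using m M_simps(1) by blast
      have "r \<otimes> (s \<ominus> k \<otimes> t) = r \<otimes> s \<ominus> r \<otimes> k \<otimes> t"
        using r k m s by (simp add: minus_eq r_distr r_minus m_assoc)
      also have "\<dots> = m" using m mR r k by (simp add: minus_eq a_assoc r_neg)
      finally have "s \<ominus> k \<otimes> t \<in> K" using m k s K(2) by auto
      then have "(s \<ominus> k \<otimes> t) \<oplus> k \<otimes> t \<in> K" using K_simps(3,4) k m by blast
      moreover have "(s \<ominus> k \<otimes> t) \<oplus> k \<otimes> t = s"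
        using k m s by (simp add: minus_eq a_assoc l_neg)
      ultimately show ?thesis by simp
    qed
    then show ?thesis using K_simps(1) by blast
  qed
  ultimately show ?thesis unfolding maximal_right_ideal_def by blast
qed

text \<open>Only closure under left multiplication by r needs an idea. If r is in M, then so is
  every \<open>r \<otimes> x\<close>. Otherwise \<open>r \<otimes> x\<close> lies in M exactly when
  x lies in the residual of M by r, which is again a maximal right ideal and so contains every x of
  the radical.\<close>

lemma (in ring) ideal_jacobson_radical: "ideal (jacobson_radical R) R"
proof -
  let ?J = "jacobson_radical R"
  have M: "right_ideal M R" if "maximal_right_ideal M R" for M
    using that by (simp add: maximal_right_ideal_def)
  have J: "right_ideal ?J R"
    using right_idealD(2-4)[OF M] by (intro right_idealI) (auto simp: jacobson_radical_def)
  have left: "r \<otimes> x \<in> ?J" if x: "x \<in> ?J" and r: "r \<in> carrier R" for r x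
  proof -
    have xR: "x \<in> carrier R" using x by (simp add: jacobson_radical_def)
    have "r \<otimes> x \<in> M" if M': "maximal_right_ideal M R" for M
    proof (cases "r \<in> M")
      case True
      then show ?thesis using right_idealD(4)[OF M[OF M']] xR by blast
    next
      case False
      then show ?thesis
        using x maximal_right_ideal_residual[OF M' r] by (auto simp: jacobson_radical_def)
    qed
    then show ?thesis using xR r by (simp add: jacobson_radical_def)
  qed
  show ?thesis
  proof (rule idealI[OF ring_axioms])
    show "subgroup ?J (add_monoid R)"
      using J by (simp add: right_ideal_def additive_subgroup_def)
  qed (use left right_idealD(4)[OF J] in blast)+
qed

text \<open>A maximal right ideal exists, so the radical is a proper two-sided ideal, and simplicity
  leaves only zero.\<close>

lemma simple_ring_jacobson_radical:
  assumes "simple_ring R"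
  shows "jacobson_radical R = {\<zero>\<^bsub>R\<^esub>}"
proof -
  interpret ring R using assms by (simp add: simple_ring_def)
  obtain M where M: "maximal_right_ideal M R"
    using maximal_right_ideal_exists assms unfolding simple_ring_def by blast
  then have "M \<subset> carrier R"
    using right_idealD(1) by (auto simp: maximal_right_ideal_def)
  with M have "jacobson_radical R \<noteq> carrier R" by (auto simp: jacobson_radical_def)
  then show ?thesis using assms ideal_jacobson_radical by (auto simp: simple_ring_def)
qed

text \<open>Surjectivity serves to lift the coefficient t of a decomposition in S to some r in R.
  Then \<open>h\<close> maps x - kr into M, so x - kr lies in the preimage and x lies in K.\<close>

lemma (in ring_hom_ring) maximal_right_ideal_vimage:
  assumes surj: "h ` carrier R = carrier S" and M: "maximal_right_ideal M S"
  shows "maximal_right_ideal {x \<in> carrier R. h x \<in> M} R"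
proof -
  let ?N = "{x \<in> carrier R. h x \<in> M}"
  have rM: "right_ideal M S" using M by (simp add: maximal_right_ideal_def)
  note M_simps = right_idealD[OF rM]
  have N: "right_ideal ?N R" using M_simps by (intro R.right_idealI) auto
  have "M \<noteq> carrier S" using M by (simp add: maximal_right_ideal_def)
  then have "\<one>\<^bsub>S\<^esub> \<notin> M" using S.right_ideal_eq_carrier[OF rM] by blast
  then have "\<one>\<^bsub>R\<^esub> \<notin> ?N" by simp
  then have "?N \<noteq> carrier R" by blast
  moreover have "K = carrier R" if K: "right_ideal K R" "?N \<subseteq> K" "K \<noteq> ?N" for K
  proof -
    note K_simps = right_idealD[OF K(1)]
    obtain k where k: "k \<in> K" "k \<in> carrier R" "h k \<notin> M" using K K_simps(1) by blast
    have "x \<in> K" if x: "x \<in> carrier R" for x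
    proof -
      obtain m t where m: "m \<in> M" "t \<in> carrier S" "h x = m \<oplus>\<^bsub>S\<^esub> h k \<otimes>\<^bsub>S\<^esub> t"
        using S.maximal_right_ideal_decompose[OF M, of "h k" "h x"] k x by auto
      obtain r where r: "r \<in> carrier R" "t = h r" using m(2) surj by blast
      have "m \<in> carrier S" using m M_simps(1) by blast
      then have "h (x \<ominus>\<^bsub>R\<^esub> k \<otimes>\<^bsub>R\<^esub> r) = m"
        using m r k x by (simp add: R.minus_eq S.a_assoc S.r_neg)
      then have "x \<ominus>\<^bsub>R\<^esub> k \<otimes>\<^bsub>R\<^esub> r \<in> K" using m r k x K(2) by auto
      then have "(x \<ominus>\<^bsub>R\<^esub> k \<otimes>\<^bsub>R\<^esub> r) \<oplus>\<^bsub>R\<^esub> k \<otimes>\<^bsub>R\<^esub> r \<in> K" using K_simps(3,4) k r by blast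
      moreover have "(x \<ominus>\<^bsub>R\<^esub> k \<otimes>\<^bsub>R\<^esub> r) \<oplus>\<^bsub>R\<^esub> k \<otimes>\<^bsub>R\<^esub> r = x"
        using k r x by (simp add: R.minus_eq R.a_assoc R.l_neg)
      ultimately show ?thesis by simp
    qed
    then show ?thesis using K_simps(1) by blast
  qed
  ultimately show ?thesis using N unfolding maximal_right_ideal_def by blast
qed

text \<open>If h avoided a maximal M, then 1 = m + hr with m in M. As hr is again in H, the element
  m = 1 - hr has a right inverse, which forces 1 into M.\<close>

lemma (in ring) quasi_regular_subset_jacobson_radical:
  assumes H: "right_ideal H R"
    and inv: "\<And>h. h \<in> H \<Longrightarrow> \<exists>s \<in> carrier R. (\<one> \<ominus> h) \<otimes> s = \<one>"
  shows "H \<subseteq> jacobson_radical R"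
proof
  fix h assume h: "h \<in> H"
  then have hR: "h \<in> carrier R" using right_idealD(1)[OF H] by blast
  have "h \<in> M" if M: "maximal_right_ideal M R" for M
  proof (rule ccontr)
    assume "h \<notin> M"
    have rM: "right_ideal M R" using M by (simp add: maximal_right_ideal_def)
    obtain m r where m: "m \<in> M" "r \<in> carrier R" "\<one> = m \<oplus> h \<otimes> r"
      using maximal_right_ideal_decompose[OF M hR \<open>h \<notin> M\<close> one_closed] by blast
    have "m \<in> carrier R" using m right_idealD(1)[OF rM] by blast
    then have "\<one> \<ominus> h \<otimes> r = m" using m hR by (simp add: minus_eq a_assoc r_neg)
    then obtain s where s: "s \<in> carrier R" "m \<otimes> s = \<one>"
      using inv[of "h \<otimes> r"] right_idealD(4)[OF H h m(2)] by auto
    then have "\<one> \<in> M" using right_idealD(4)[OF rM m(1) s(1)] by simp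
    then show False
      using right_ideal_eq_carrier[OF rM] M by (simp add: maximal_right_ideal_def)
  qed
  with hR show "h \<in> jacobson_radical R" by (simp add: jacobson_radical_def)
qed


section \<open>Convergence in complete groups and right inverses of 1 - h\<close>

section \<open>Geometric series\<close>

text \<open>The sequence is eventually constant in each quotient G/U. These eventual cosets form a
  point of the inverse limit, and completeness provides an element l that induces it.\<close>

lemma complete_ab_group_coset_limit:
  fixes s :: "nat \<Rightarrow> 'a"
  assumes compl: "complete_ab_group G T" and s: "\<And>n. s n \<in> carrier G"
    and cauchy: "\<And>U. U \<in> open_subgroups G T \<Longrightarrow> \<exists>N. \<forall>n\<ge>N. U #>\<^bsub>G\<^esub> s n = U #>\<^bsub>G\<^esub> s N"
  obtains l where "l \<in> carrier G"
    "\<And>U. U \<in> open_subgroups G T \<Longrightarrow> \<exists>N. \<forall>n\<ge>N. U #>\<^bsub>G\<^esub> s n = U #>\<^bsub>G\<^esub> l"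
proof -
  define N where "N U = (SOME N. \<forall>n\<ge>N. U #>\<^bsub>G\<^esub> s n = U #>\<^bsub>G\<^esub> s N)" for U
  have N: "U #>\<^bsub>G\<^esub> s n = U #>\<^bsub>G\<^esub> s (N U)" if "U \<in> open_subgroups G T" "n \<ge> N U" for U n
  proof -
    have "\<forall>n\<ge>N U. U #>\<^bsub>G\<^esub> s n = U #>\<^bsub>G\<^esub> s (N U)"
      unfolding N_def by (rule someI_ex[OF cauchy[OF that(1)]])
    from this[rule_format, OF that(2)] show ?thesis .
  qed
  define c where "c = (\<lambda>U \<in> open_subgroups G T. U #>\<^bsub>G\<^esub> s (N U))"
  have "c \<in> coset_limit G T"
    unfolding coset_limit_def
  proof (intro CollectI conjI ballI impI)
    show "c \<in> (\<Pi>\<^sub>E U \<in> open_subgroups G T. carrier (G Mod U))"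
      using s by (auto simp: c_def carrier_FactGroup)
    fix U V assume UV: "U \<in> open_subgroups G T" "V \<in> open_subgroups G T" "U \<subseteq> V"
    \<comment> \<open>Past both thresholds the two cosets have the common representative
      \<open>s ?n\<close>, so U inside V gives the compatibility of the family.\<close>
    let ?n = "max (N U) (N V)"
    have "c U = U #>\<^bsub>G\<^esub> s ?n" "c V = V #>\<^bsub>G\<^esub> s ?n"
      using UV N[of U ?n] N[of V ?n] by (simp_all add: c_def)
    with UV(3) show "c U \<subseteq> c V" by (auto simp: r_coset_def)
  qed
  then obtain l where l: "l \<in> carrier G" "c = to_coset_limit G T l"
    using compl by (auto simp: complete_ab_group_def)
  have "\<exists>N. \<forall>n\<ge>N. U #>\<^bsub>G\<^esub> s n = U #>\<^bsub>G\<^esub> l" if "U \<in> open_subgroups G T" for U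
  proof -
    have "U #>\<^bsub>G\<^esub> s (N U) = U #>\<^bsub>G\<^esub> l"
      using fun_cong[OF l(2), of U] that by (simp add: c_def to_coset_limit_def)
    then have "\<forall>n\<ge>N U. U #>\<^bsub>G\<^esub> s n = U #>\<^bsub>G\<^esub> l"
      using N[OF that] by (metis (full_types))
    then show ?thesis by (rule exI)
  qed
  then show ?thesis by (rule that[OF l(1)])
qed

lemma (in ring) geometric_sum:
  assumes "h \<in> carrier R"
  shows "(\<one> \<ominus> h) \<otimes> (\<Oplus>k\<in>{..<n}. h [^] k) = \<one> \<ominus> h [^] (n::nat)"
proof (induction n)
  case 0
  then show ?case using assms by (simp add: minus_eq r_neg)
next
  case (Suc n)
  have "h \<otimes> h [^] n = h [^] Suc n" using assms nat_pow_Suc2 by metis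
  then have "(\<one> \<ominus> h) \<otimes> h [^] n = h [^] n \<ominus> h [^] Suc n"
    using assms by (simp add: minus_eq l_distr l_minus)
  moreover have "(\<Oplus>k\<in>{..<Suc n}. h [^] k) = h [^] n \<oplus> (\<Oplus>k\<in>{..<n}. h [^] k)"
    using assms by (simp add: lessThan_Suc)
  ultimately have "(\<one> \<ominus> h) \<otimes> (\<Oplus>k\<in>{..<Suc n}. h [^] k)
      = (h [^] n \<ominus> h [^] Suc n) \<oplus> (\<one> \<ominus> h [^] n)"
    using assms Suc by (simp add: r_distr del: nat_pow_Suc)
  also have "\<dots> = \<one> \<ominus> h [^] Suc n"
  proof -
    have "a \<in> carrier R \<Longrightarrow> b \<in> carrier R \<Longrightarrow> (a \<ominus> b) \<oplus> (\<one> \<ominus> a) = \<one> \<ominus> b" for a b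
      by (simp add: minus_eq a_ac r_neg1 r_neg2)
    then show ?thesis using assms by simp
  qed
  finally show ?case .
qed

text \<open>The partial sums of the powers of h are Cauchy because consecutive ones differ by a
  power of h, and these powers tend to zero. Their limit l is the inverse: by the telescoping
  identity, \<open>\<one> \<ominus> (\<one> \<ominus> h) \<otimes> l\<close> lies in every open
  subgroup, so it vanishes by separatedness.\<close>

lemma (in ring) geometric_series_right_inverse:
  assumes top: "topological_ring R T"
    and compl: "complete_ab_group (add_monoid R) T"
    and sep: "separated_ab_group (add_monoid R) T"
    and h: "h \<in> carrier R"
    and lim: "limitin T (\<lambda>n. h [^] n) \<zero> sequentially"
  shows "\<exists>s \<in> carrier R. (\<one> \<ominus> h) \<otimes> s = \<one>"
proof -
  let ?G = "add_monoid R"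
  let ?O = "open_subgroups ?G T"
  have tg: "topological_ab_group ?G T" using top by (simp add: topological_ring_def)
  then have ts: "topspace T = carrier R" by (simp add: topological_ab_group_def)
  have O: "additive_subgroup U R" "openin T U" if "U \<in> ?O" for U
    using that by (auto simp: open_subgroups_def additive_subgroup_def)
  have coset: "U #>\<^bsub>?G\<^esub> x = U #>\<^bsub>?G\<^esub> y \<longleftrightarrow> x \<ominus> y \<in> U"
    if "U \<in> ?O" "x \<in> carrier R" "y \<in> carrier R" for U x y
  proof -
    interpret additive_subgroup U R using O(1) that by blast
    have s: "subgroup U ?G" by (rule a_subgroup)
    have "x \<in> U +> y \<longleftrightarrow> x \<ominus> y \<in> U"
      by (rule abelian_subgroup.a_rcos_module_minus[OF
            abelian_subgroupI3[OF additive_subgroup_axioms abelian_group_axioms] ring_axioms that(3,2)])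
    moreover have "U #>\<^bsub>?G\<^esub> x = U #>\<^bsub>?G\<^esub> y \<longleftrightarrow> x \<in> U #>\<^bsub>?G\<^esub> y"
      using add.repr_independence[OF _ _ s, of x y] add.rcos_self[OF _ s, of x] that(2,3)
      by (metis partial_object.select_convs(1) monoid.simps(1))
    ultimately show ?thesis by (simp add: a_r_coset_def)
  qed
  have ev: "\<exists>N::nat. \<forall>n\<ge>N. h [^] n \<in> U" if "U \<in> ?O" for U
    using lim[unfolded limitin_sequentially] O(2)[OF that]
      additive_subgroup.zero_closed[OF O(1)[OF that]]
    by simp
  define s where "s n = (\<Oplus>k\<in>{..<n}. h [^] k)" for n :: nat
  have sR: "s n \<in> carrier R" for n using h by (auto simp: s_def)
  have s_Suc: "s (Suc n) = h [^] n \<oplus> s n" for n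
    using h by (simp add: s_def lessThan_Suc)
  have cauchy: "\<exists>N. \<forall>n\<ge>N. U #>\<^bsub>?G\<^esub> s n = U #>\<^bsub>?G\<^esub> s N" if U: "U \<in> ?O" for U
  proof -
    obtain N :: nat where N: "\<forall>n\<ge>N. h [^] n \<in> U" using ev[OF U] by blast
    \<comment> \<open>U is a subgroup, so it is enough to compare consecutive partial sums.\<close>
    have "U #>\<^bsub>?G\<^esub> s n = U #>\<^bsub>?G\<^esub> s N" if "n \<ge> N" for n
      using that
    proof (induction n rule: dec_induct)
      case (step n)
      have "s (Suc n) \<ominus> s n = h [^] n"
        using s_Suc sR h by (simp add: minus_eq a_assoc r_neg)
      then have "U #>\<^bsub>?G\<^esub> s (Suc n) = U #>\<^bsub>?G\<^esub> s n"
        using coset[OF U sR sR] N step by simp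
      with step show ?case by simp
    qed simp
    then show ?thesis by blast
  qed
  obtain l where "l \<in> carrier ?G" and
    l: "\<And>U. U \<in> ?O \<Longrightarrow> \<exists>N. \<forall>n\<ge>N. U #>\<^bsub>?G\<^esub> s n = U #>\<^bsub>?G\<^esub> l"
    using complete_ab_group_coset_limit[OF compl, of s] sR cauchy by auto
  then have lR: "l \<in> carrier R" by simp
  let ?u = "\<one> \<ominus> h"
  have uR: "?u \<in> carrier R" using h by simp
  \<comment> \<open>For every n the error equals (1 - h)(s n - l) + h^n; for large n both summands
    lie in U.\<close>
  have diff: "\<one> \<ominus> ?u \<otimes> l \<in> U" if U: "U \<in> ?O" for U
  proof -
    interpret U: additive_subgroup U R using O(1)[OF U] .
    \<comment> \<open>U need not be stable under left multiplication. Continuity of the product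
      gives a smaller open subgroup V that \<open>?u\<close> multiplies into U, and s n - l is taken
      in V.\<close>
    let ?W = "{y \<in> topspace T. ?u \<otimes> y \<in> U}"
    have "continuous_map T (prod_topology T T) (\<lambda>y. (?u, y))"
      using uR ts by (simp add: continuous_map_pairedI)
    moreover have "continuous_map (prod_topology T T) T (\<lambda>(x, y). x \<otimes> y)"
      using top by (simp add: topological_ring_def)
    ultimately have "continuous_map T T (\<lambda>y. ?u \<otimes> y)"
      using continuous_map_compose by (fastforce simp: o_def)
    then have "openin T ?W"
      using O(2)[OF U] by (rule openin_continuous_map_preimage)
    moreover have "\<zero> \<in> ?W" using uR ts U.zero_closed by simp
    ultimately obtain V where V: "V \<in> ?O" "V \<subseteq> ?W"
      using tg unfolding topological_ab_group_def by auto
    obtain N1 N2 :: nat where N: "\<forall>n\<ge>N1. V #>\<^bsub>?G\<^esub> s n = V #>\<^bsub>?G\<^esub> l" "\<forall>n\<ge>N2. h [^] n \<in> U"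
      using l[OF V(1)] ev[OF U] by blast
    define n where "n = max N1 N2"
    have "s n \<ominus> l \<in> V" using N coset[OF V(1) sR lR] by (simp add: n_def)
    then have "?u \<otimes> (s n \<ominus> l) \<in> U" using V(2) by blast
    moreover have "h [^] n \<in> U" using N by (simp add: n_def)
    ultimately have "?u \<otimes> (s n \<ominus> l) \<oplus> h [^] n \<in> U" by simp
    moreover have "?u \<otimes> (s n \<ominus> l) \<oplus> h [^] n = \<one> \<ominus> ?u \<otimes> l"
    proof -
      have "?u \<otimes> (s n \<ominus> l) = (\<one> \<ominus> h [^] n) \<ominus> ?u \<otimes> l"
        using geometric_sum[OF h, of n] sR lR uR
        by (simp add: s_def[symmetric] minus_eq r_distr r_minus)
      moreover have "((\<one> \<ominus> a) \<ominus> b) \<oplus> a = \<one> \<ominus> b"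
        if "a \<in> carrier R" "b \<in> carrier R" for a b
      proof -
        have "((\<one> \<ominus> a) \<ominus> b) \<oplus> a = \<one> \<oplus> (\<ominus> a \<oplus> (a \<oplus> \<ominus> b))"
          using that by (simp add: minus_eq a_ac)
        then show ?thesis using that by (simp add: minus_eq r_neg1)
      qed
      ultimately show ?thesis using uR lR h by simp
    qed
    ultimately show ?thesis by simp
  qed
  have "to_coset_limit ?G T \<one> = to_coset_limit ?G T (?u \<otimes> l)"
    unfolding to_coset_limit_def
    by (rule restrict_ext) (use coset[THEN iffD2] diff uR lR in simp)
  then have "?u \<otimes> l = \<one>"
    using sep uR lR unfolding separated_ab_group_def
    by (metis inj_onD m_closed monoid.simps(1) one_closed partial_object.select_convs(1))
  with lR show ?thesis by blast
qed

text \<open>The exponent is shifted because the partial product with index 0 already has one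
  factor.\<close>

lemma (in ring) partial_product_const:
  assumes "h \<in> carrier R"
  shows "partial_product R (\<lambda>_. h) n = h [^] Suc n"
  using assms by (induction n) auto

text \<open>T-nilpotence, applied to the constant sequence h, h, ..., says that the powers of h tend
  to zero; the geometric series then makes H quasi-regular.\<close>

lemma T_nilpotent_ideal_subset_jacobson_radical:
  assumes top: "topological_ring R T"
    and "complete_ab_group (add_monoid R) T"
    and "separated_ab_group (add_monoid R) T"
    and H: "ideal H R"
    and nil: "topologically_left_T_nilpotent R T H"
  shows "H \<subseteq> jacobson_radical R"
proof -
  interpret ideal H R by (rule H)
  have "right_ideal H R"
    using I_r_closed by (simp add: right_ideal_def additive_subgroup_axioms)
  moreover have "\<exists>s \<in> carrier R. (\<one>\<^bsub>R\<^esub> \<ominus>\<^bsub>R\<^esub> h) \<otimes>\<^bsub>R\<^esub> s = \<one>\<^bsub>R\<^esub>" if h: "h \<in> H" for h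
  proof (rule geometric_series_right_inverse[OF assms(1-3)])
    show hR: "h \<in> carrier R" using h by (rule a_Hcarr)
    have "limitin T (partial_product R (\<lambda>_. h)) \<zero>\<^bsub>R\<^esub> sequentially"
      using nil h unfolding topologically_left_T_nilpotent_def by auto
    moreover have "partial_product R (\<lambda>_. h) = (\<lambda>n. h [^]\<^bsub>R\<^esub> (n + 1))"
      using partial_product_const[OF hR] by auto
    ultimately have "limitin T (\<lambda>n. h [^]\<^bsub>R\<^esub> (n + 1)) \<zero>\<^bsub>R\<^esub> sequentially" by simp
    then show "limitin T (\<lambda>n. h [^]\<^bsub>R\<^esub> n) \<zero>\<^bsub>R\<^esub> sequentially"
      by (rule limitin_sequentially_offset_rev)
  qed
  ultimately show ?thesis by (rule quasi_regular_subset_jacobson_radical)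
qed


section \<open>Open maximal right ideals coming from the simple factors\<close>

section \<open>Quotients that are products of discrete simple rings\<close>

lemma product_ring_projection:
  assumes "i \<in> I"
  shows "(\<lambda>x. x i) \<in> ring_hom (product_ring I S) (S i)"
  using assms by (auto simp: ring_hom_def product_ring_def)

lemma product_ring_projection_surj:
  assumes "i \<in> I" and "\<And>j. j \<in> I \<Longrightarrow> ring (S j)"
  shows "(\<lambda>x. x i) ` carrier (product_ring I S) = carrier (S i)"
proof (intro equalityI subsetI)
  fix a assume a: "a \<in> carrier (S i)"
  \<comment> \<open>A preimage of a under the projection: a in coordinate i and zero in the
    others.\<close>
  let ?x = "\<lambda>j\<in>I. if j = i then a else \<zero>\<^bsub>S j\<^esub>"
  have "?x \<in> carrier (product_ring I S)"
    using a assms(2) by (auto simp: product_ring_def ring.ring_simprules(2))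
  then show "a \<in> (\<lambda>x. x i) ` carrier (product_ring I S)"
    by (rule rev_image_eqI) (use assms(1) in simp)
qed (use assms in \<open>auto simp: product_ring_def\<close>)

text \<open>Each composite R -> R/H -> product -> \<open>S \<gamma>\<close> is a continuous
  surjection onto a discrete ring, so it pulls maximal right ideals back to open ones. An element of
  the topological radical therefore lands in the zero radical of every factor and vanishes in
  R/H.\<close>

lemma topological_jacobson_radical_subset:
  assumes top: "topological_ring R T" and H: "ideal H R"
    and simple: "\<And>\<gamma>. \<gamma> \<in> \<Gamma> \<Longrightarrow> simple_ring (S \<gamma>)"
    and iso: "topological_ring_isomorphic
           (R Quot H) (coset_topology (add_monoid R) T H)
           (product_ring \<Gamma> S) (product_topology (\<lambda>\<gamma>. discrete_topology (carrier (S \<gamma>))) \<Gamma>)"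
  shows "topological_jacobson_radical R T \<subseteq> H"
proof
  interpret ideal H R by (rule H)
  let ?D = "\<lambda>\<gamma>. discrete_topology (carrier (S \<gamma>))"
  let ?q = "\<lambda>x. H +>\<^bsub>R\<^esub> x"
  have ts: "topspace T = carrier R"
    using top by (simp add: topological_ring_def topological_ab_group_def)
  have q: "?q \<in> ring_hom R (R Quot H)" "?q ` carrier R = carrier (R Quot H)"
    by (rule rcos_ring_hom) (auto simp: FactRing_def A_RCOSETS_def')
  have cq: "continuous_map T (coset_topology (add_monoid R) T H) ?q"
    using quotient_imp_continuous_map[OF quotient_map_coset_topology[of T "add_monoid R" H]] ts
    by (simp add: a_r_coset_def)
  obtain \<phi> where \<phi>: "\<phi> \<in> ring_iso (R Quot H) (product_ring \<Gamma> S)"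
    and hom: "homeomorphic_map (coset_topology (add_monoid R) T H) (product_topology ?D \<Gamma>) \<phi>"
    using iso unfolding topological_ring_isomorphic_def by blast
  have \<phi>_hom: "\<phi> \<in> ring_hom (R Quot H) (product_ring \<Gamma> S)"
    and \<phi>_bij: "bij_betw \<phi> (carrier (R Quot H)) (carrier (product_ring \<Gamma> S))"
    using \<phi> by (auto simp: ring_iso_def)
  define f where "f \<gamma> = (\<lambda>x. \<phi> (?q x) \<gamma>)" for \<gamma>
  have ringS: "ring (S \<gamma>)" if "\<gamma> \<in> \<Gamma>" for \<gamma> using simple[OF that] by (simp add: simple_ring_def)
  have f_hom: "ring_hom_ring R (S \<gamma>) (f \<gamma>)" if "\<gamma> \<in> \<Gamma>" for \<gamma>
  proof (rule ring_hom_ringI2[OF ring_axioms ringS[OF that]])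
    show "f \<gamma> \<in> ring_hom R (S \<gamma>)"
      using ring_hom_trans[OF ring_hom_trans[OF q(1) \<phi>_hom] product_ring_projection[OF that]]
      by (simp add: f_def o_def)
  qed
  have f_surj: "f \<gamma> ` carrier R = carrier (S \<gamma>)" if "\<gamma> \<in> \<Gamma>" for \<gamma>
  proof -
    have "f \<gamma> ` carrier R = (\<lambda>x. x \<gamma>) ` \<phi> ` ?q ` carrier R" by (simp add: f_def image_image)
    also have "\<dots> = carrier (S \<gamma>)"
      using q(2) \<phi>_bij product_ring_projection_surj[of \<gamma> \<Gamma> S] that ringS
      by (simp add: bij_betw_imp_surj_on)
    finally show ?thesis .
  qed
  have f_cont: "continuous_map T (?D \<gamma>) (f \<gamma>)" if "\<gamma> \<in> \<Gamma>" for \<gamma>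
    using continuous_map_compose[OF continuous_map_compose[OF cq homeomorphic_imp_continuous_map[OF hom]]
        continuous_map_product_projection[OF that]]
    by (simp add: f_def o_def)
  fix x assume x: "x \<in> topological_jacobson_radical R T"
  then have xR: "x \<in> carrier R" by (simp add: topological_jacobson_radical_def)
  have f0: "f \<gamma> x = f \<gamma> \<zero>\<^bsub>R\<^esub>" if \<gamma>: "\<gamma> \<in> \<Gamma>" for \<gamma>
  proof -
    interpret f: ring_hom_ring R "S \<gamma>" "f \<gamma>" by (rule f_hom[OF \<gamma>])
    have "f \<gamma> x \<in> M" if M: "maximal_right_ideal M (S \<gamma>)" for M
    proof -
      let ?N = "{x \<in> carrier R. f \<gamma> x \<in> M}"
      have "M \<subseteq> carrier (S \<gamma>)"
        using M right_idealD(1) by (auto simp: maximal_right_ideal_def)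
      then have "openin T ?N"
        using openin_continuous_map_preimage[OF f_cont[OF \<gamma>], of M] ts by simp
      then show ?thesis
        using x f.maximal_right_ideal_vimage[OF f_surj[OF \<gamma>] M]
        by (auto simp: topological_jacobson_radical_def)
    qed
    then have "f \<gamma> x \<in> jacobson_radical (S \<gamma>)" using xR by (simp add: jacobson_radical_def)
    then show ?thesis using simple_ring_jacobson_radical[OF simple[OF \<gamma>]] by simp
  qed
  \<comment> \<open>Agreement on \<open>\<Gamma>\<close> gives equality only for functions with the
    default value outside \<open>\<Gamma>\<close>.\<close>
  have ext: "\<phi> (?q y) \<in> extensional \<Gamma>" if "y \<in> carrier R" for y
  proof -
    have "\<phi> (?q y) \<in> carrier (product_ring \<Gamma> S)"
      using imageI[OF that, of ?q] q(2) bij_betwE[OF \<phi>_bij] by simp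
    then show ?thesis by (simp add: product_ring_def PiE_def)
  qed
  have "\<phi> (?q x) = \<phi> (?q \<zero>\<^bsub>R\<^esub>)"
    using f0 by (intro extensionalityI[OF ext[OF xR] ext[OF zero_closed]]) (simp add: f_def)
  then have "?q x = ?q \<zero>\<^bsub>R\<^esub>"
    by (rule inj_onD[OF bij_betw_imp_inj_on[OF \<phi>_bij]])
       (use q(2) imageI[OF xR, of ?q] imageI[OF zero_closed, of ?q] in simp_all)
  \<comment> \<open>The element x lies in its own coset, which is the coset of zero, that is,
    H.\<close>
  then show "x \<in> H"
    using a_rcos_self[OF xR]
      a_rcos_zero[OF H additive_subgroup.zero_closed[OF additive_subgroup_axioms]] by simp
qed

theorem lemma9p1:
  fixes R :: "('a, 'm) ring_scheme"
    and T :: "'a topology"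
    and H :: "'a set"
    and \<Gamma> :: "'i set"
    and S :: "'i \<Rightarrow> ('s, 'n) ring_scheme"
  assumes "topological_ring R T"
    and "complete_ab_group (add_monoid R) T"
    and "separated_ab_group (add_monoid R) T"
    and "base_of_open_right_ideals R T"
    and "ideal H R"
    and "topologically_left_T_nilpotent R T H"
    and "strongly_closed (add_monoid R) T H"
    and "\<And>\<gamma>. \<gamma> \<in> \<Gamma> \<Longrightarrow> simple_ring (S \<gamma>) \<and> artinian_ring (S \<gamma>)"
    and "topological_ring_isomorphic
           (R Quot H) (coset_topology (add_monoid R) T H)
           (product_ring \<Gamma> S) (product_topology (\<lambda>\<gamma>. discrete_topology (carrier (S \<gamma>))) \<Gamma>)"
  shows "H = topological_jacobson_radical R T \<and> H = jacobson_radical R"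
proof -
  \<comment> \<open>A cycle of three inclusions makes the sets equal. The middle one holds because
    the topological radical intersects only the open ones among the maximal right ideals.\<close>
  have "H \<subseteq> jacobson_radical R"
    by (rule T_nilpotent_ideal_subset_jacobson_radical[OF assms(1-3,5,6)])
  moreover have "jacobson_radical R \<subseteq> topological_jacobson_radical R T"
    by (auto simp: jacobson_radical_def topological_jacobson_radical_def)
  moreover have "topological_jacobson_radical R T \<subseteq> H"
    using assms(8) by (intro topological_jacobson_radical_subset[OF assms(1,5) _ assms(9)]) blast
  ultimately show ?thesis by blast
qed

end
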